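(* Fix $\eta\in\{-1,1\}$. Let $p,q\in\mathcal{G}$ be the probability mass functions of the random variables $X\sim p$ and $Y\sim q$, with supports $S_p=\{0,\ldots,M\}$ and $S_q=\{0,\ldots,N\}$, $0\le N\le M\le\infty$ (so that $S_q\subseteq S_p$), and let $l:\mathbb{Z}\to\mathbb{R}$ be a function such that ${\rm E}_p[l(X)]$ and ${\rm E}_q[l(Y)]$ exist. Define $f_l^{p,\eta}:\mathbb{Z}\to\mathbb{R}$ by $$f_l^{p,\eta}(x)=\frac{1}{p(x)}\sum_{k=0}^{x-1}\bigl(l(k)-{\rm E}_p[l(X)]\bigr)p(k)\quad\text{if }\eta=1,$$ $$f_l^{p,\eta}(x)=\frac{1}{p(x)}\sum_{k=0}^{x}\bigl(l(k)-{\rm E}_p[l(X)]\bigr)p(k)\quad\text{if }\eta=-1,$$ and suppose that $f_l^{p,\eta}\in\mathcal{F}^{\eta}(p)\cap\mathcal{F}^{\eta}(q)$. Then $${\rm E}_q[l(Y)]-{\rm E}_p[l(X)]={\rm E}_q\left[f_l^{p,\eta}(Y+\eta)\,r^{\eta}(p,q)(Y)\right],$$ where $$r^{\eta}(p,q)(x):=\frac{1}{\eta}\left(\frac{p(x+\eta)}{p(x)}-\frac{q(x+\eta)}{q(x)}\right).$$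
   Context: $\mathcal{G}$ is the collection of probability mass functions $p:\mathbb{Z}\to[0,1]$ whose support $S_p:=\{x\in\mathbb{Z}:p(x)>0\}$ is a discrete interval $[a,b]:=\{a,a+1,\ldots,b\}$ with $a<b$, $a,b\in\mathbb{Z}\cup\{\pm\infty\}$ (infinite endpoints are not elements of the interval). Conventions: sums over empty index sets equal $0$, and $1/p(x)$ is understood to be $0$ when $x\notin S_p$ (for every $p\in\mathcal{G}$). For $p\in\mathcal{G}$, ${\rm E}_p[l(X)]=\sum_{x\in S_p}l(x)p(x)$ for $p$-summable $l$. For $\eta\in\{-1,1\}$ and $h:\mathbb{Z}\to\mathbb{R}$, $\Delta^{\eta}h(x)=\frac{1}{\eta}\left(h(x+\eta)-h(x)\right)$. For $p\in\mathcal{G}$ with support $[a,b]$, $\mathcal{F}^{\eta}(p)$ is the collection of functions $f:\mathbb{Z}\to\mathbb{R}$ such that $\sum_{j=a}^{b}\Delta^{\eta}(f(j)p(j))=0$ (meaning that $j\mapsto\Delta^{\eta}(f(j)p(j))$ is summable over $[a,b]$ with sum $0$). *)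

theory Defs
  imports "HOL-Probability.Probability" "HOL-Library.Extended"
begin

text \<open>Endpoints live in the integers together with \<open>Minf\<close> and \<open>Pinf\<close>;
  infinite endpoints are not elements of the interval.\<close>

definition discrete_interval :: "int extended \<Rightarrow> int extended \<Rightarrow> int set"
  where "discrete_interval a b = {x. a \<le> Fin x \<and> Fin x \<le> b}"

definition interval_pmfs :: "int pmf set"
  where "interval_pmfs = {p. \<exists>a b. a < b \<and> set_pmf p = discrete_interval a b}"

definition fdiff :: "int \<Rightarrow> (int \<Rightarrow> real) \<Rightarrow> int \<Rightarrow> real"
  where "fdiff \<eta> h x = 1 / of_int \<eta> * (h (x + \<eta>) - h x)"

text \<open>The class \<open>F\<^sup>\<eta>(p)\<close>. The sum over the support is unconditional, as \<open>has_sum\<close>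
  on the reals amounts to absolute summability.\<close>

definition stein_class :: "int \<Rightarrow> int pmf \<Rightarrow> (int \<Rightarrow> real) set"
  where "stein_class \<eta> p =
    {f. (fdiff \<eta> (\<lambda>i. f i * pmf p i) has_sum 0) (set_pmf p)}"

text \<open>The function \<open>f\<^sub>l\<close> for a mass function \<open>p\<close> whose support starts at \<open>0\<close> and for
  \<open>\<eta>\<close> in \<open>{-1, 1}\<close>. Division by zero in HOL implements the convention that \<open>1 / p(x) = 0\<close>
  off the support; the same holds for \<open>ratio_diff\<close> below.\<close>

definition stein_fun :: "int \<Rightarrow> int pmf \<Rightarrow> (int \<Rightarrow> real) \<Rightarrow> int \<Rightarrow> real"
  where "stein_fun \<eta> p l x =
    (if \<eta> = 1
     then 1 / pmf p x * (\<Sum>k=0..x-1. (l k - measure_pmf.expectation p l) * pmf p k)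
     else 1 / pmf p x * (\<Sum>k=0..x. (l k - measure_pmf.expectation p l) * pmf p k))"

definition ratio_diff :: "int \<Rightarrow> int pmf \<Rightarrow> int pmf \<Rightarrow> int \<Rightarrow> real"
  where "ratio_diff \<eta> p q x =
    1 / of_int \<eta> * (pmf p (x + \<eta>) / pmf p x - pmf q (x + \<eta>) / pmf q x)"

end

theory Submission
  imports Defs
begin

text \<open>On the support of \<open>p\<close> the Stein function \<open>f\<close> solves the Stein equation
  \<open>\<Delta>\<^sup>\<eta>(f p)(x) = (l(x) - E\<^sub>p l) p(x)\<close>. Consequently
  \<open>f(y + \<eta>) r\<^sup>\<eta>(p, q)(y) = l(y) - E\<^sub>p l - \<Delta>\<^sup>\<eta>(f q)(y) / q(y)\<close> on the support of \<open>q\<close>, and the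
  last term has mean \<open>0\<close> under \<open>q\<close> because \<open>f\<close> lies in \<open>F\<^sup>\<eta>(q)\<close>.\<close>

text \<open>Weighting by \<open>pmf q\<close> cancels the division on the support, and unconditional
  summability of reals is absolute, hence integrability. With \<open>s = 0\<close> this turns
  membership in \<open>stein_class \<eta> q\<close> into a mean-zero statement under
  \<open>q\<close>.\<close>

lemma expectation_pmf_has_sum:
  fixes g :: "'a \<Rightarrow> real"
  assumes "(g has_sum s) (set_pmf q)"
  shows "integrable (measure_pmf q) (\<lambda>x. g x / pmf q x)"
    and "measure_pmf.expectation q (\<lambda>x. g x / pmf q x) = s"
proof -
  define h where "h x = pmf q x * (g x / pmf q x)" for x
  have "(h has_sum s) UNIV \<longleftrightarrow> (g has_sum s) (set_pmf q)"
    by (rule has_sum_cong_neutral) (auto simp: h_def pmf_eq_0_set_pmf)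
  with assms have h: "(h has_sum s) UNIV"
    by simp
  then have "h summable_on UNIV"
    by (rule has_sum_imp_summable)
  then have abs: "Infinite_Set_Sum.abs_summable_on h UNIV"
    using summable_on_iff_abs_summable_on_real abs_summable_equivalent by blast
  then show "integrable (measure_pmf q) (\<lambda>x. g x / pmf q x)"
    unfolding measure_pmf_eq_density
    by (subst integrable_density) (simp_all add: abs_summable_on_def h_def)
  show "measure_pmf.expectation q (\<lambda>x. g x / pmf q x) = s"
    using infsetsum_infsum[OF abs] infsumI[OF h]
    by (simp add: pmf_expectation_eq_infsetsum h_def)
qed

lemma sum_centred_eq_0:
  assumes "finite A" "set_pmf p \<subseteq> A"
  shows "(\<Sum>k\<in>A. (l k - measure_pmf.expectation p l) * pmf p k) = (0::real)"
proof -
  have "(\<Sum>k\<in>A. pmf p k) = 1"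
    using assms by (rule sum_pmf_eq_1)
  moreover have "measure_pmf.expectation p l = (\<Sum>k\<in>A. l k * pmf p k)"
    using integral_measure_pmf_real[OF assms(1), of p l] assms(2) by auto
  ultimately show ?thesis
    by (simp add: left_diff_distrib sum_subtractf flip: sum_distrib_left)
qed

text \<open>Past the right end of the support both sides are \<open>0\<close>, the right one because it is then the
  full centred sum; this is what makes the Stein equation valid at the endpoints.\<close>

lemma stein_fun_mult_pmf:
  assumes p: "set_pmf p = discrete_interval (Fin 0) M"
  shows "stein_fun \<eta> p l x * pmf p x =
    (\<Sum>k = 0..(if \<eta> = 1 then x - 1 else x). (l k - measure_pmf.expectation p l) * pmf p k)"
proof (cases "x \<in> set_pmf p")
  case True
  then show ?thesis
    by (simp add: stein_fun_def pmf_eq_0_set_pmf)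
next
  case False
  have mem: "y \<in> set_pmf p \<longleftrightarrow> 0 \<le> y \<and> Fin y \<le> M" for y
    unfolding p discrete_interval_def by simp
  have "set_pmf p \<subseteq> {0..<x}" if "0 \<le> x"
  proof
    fix y
    assume y: "y \<in> set_pmf p"
    \<comment> \<open>The support has no gaps above 0, so a nonnegative \<open>x\<close> outside it
      exceeds every support point.\<close>
    have "\<not> Fin x \<le> Fin y"
      using that False y order_trans[of "Fin x" "Fin y" M] by (simp only: mem) blast
    with y show "y \<in> {0..<x}"
      by (simp add: mem)
  qed
  then have "x < 0 \<or> set_pmf p \<subseteq> {0..<x}"
    by linarith
  then show ?thesis
  proof
    assume "set_pmf p \<subseteq> {0..<x}"
    \<comment> \<open>Either upper limit is at least \<open>x - 1\<close>, so the sum covers the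
      whole support.\<close>
    then have "set_pmf p \<subseteq> {0..(if \<eta> = 1 then x - 1 else x)}"
      by auto
    from sum_centred_eq_0[OF _ this] False show ?thesis
      by (simp add: pmf_eq_0_set_pmf)
  qed (use False in \<open>simp add: pmf_eq_0_set_pmf\<close>)
qed

text \<open>For both signs of \<open>\<eta>\<close> the difference is the partial sum up to
  \<open>x\<close> minus the one up to \<open>x - 1\<close>: when \<open>\<eta> = -1\<close>, the
  factor \<open>1 / \<eta>\<close> restores the order. Only the term at \<open>x\<close>
  survives.\<close>

lemma fdiff_stein_fun:
  assumes \<eta>: "\<eta> \<in> {-1, 1}"
    and p: "set_pmf p = discrete_interval (Fin 0) M"
    and x: "x \<in> set_pmf p"
  shows "fdiff \<eta> (\<lambda>i. stein_fun \<eta> p l i * pmf p i) x =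
    (l x - measure_pmf.expectation p l) * pmf p x"
proof -
  have "{0..x} = insert x {0..x - 1}"
    using x p by (auto simp: discrete_interval_def)
  then show ?thesis
    using \<eta> by (auto simp: fdiff_def stein_fun_mult_pmf[OF p])
qed

lemma stein_fun_mult_ratio_diff:
  assumes "\<eta> \<in> {-1, 1}"
    and "set_pmf p = discrete_interval (Fin 0) M"
    and "y \<in> set_pmf p" and "y \<in> set_pmf q"
  shows "stein_fun \<eta> p l (y + \<eta>) * ratio_diff \<eta> p q y =
    l y - measure_pmf.expectation p l
      - fdiff \<eta> (\<lambda>i. stein_fun \<eta> p l i * pmf q i) y / pmf q y"
proof -
  have pos: "pmf p y > 0" "pmf q y > 0"
    using assms(3,4) by (simp_all add: pmf_positive)
  \<comment> \<open>Each quotient on the right contributes the value of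
    \<open>stein_fun \<eta> p l\<close> at \<open>y\<close> itself with the same factor, so these
    values cancel.\<close>
  then have "stein_fun \<eta> p l (y + \<eta>) * ratio_diff \<eta> p q y =
      fdiff \<eta> (\<lambda>i. stein_fun \<eta> p l i * pmf p i) y / pmf p y
      - fdiff \<eta> (\<lambda>i. stein_fun \<eta> p l i * pmf q i) y / pmf q y"
    by (simp add: fdiff_def ratio_diff_def diff_divide_distrib right_diff_distrib)
  also have "fdiff \<eta> (\<lambda>i. stein_fun \<eta> p l i * pmf p i) y / pmf p y = l y - measure_pmf.expectation p l"
    using fdiff_stein_fun[OF assms(1-3), of l] pos by simp
  finally show ?thesis .
qed

theorem lemma2p1:
  fixes \<eta> :: int and p q :: "int pmf" and M N :: "int extended" and l :: "int \<Rightarrow> real"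
  assumes "\<eta> \<in> {-1, 1}"
    and "p \<in> interval_pmfs" and "q \<in> interval_pmfs"
    and "set_pmf p = discrete_interval (Fin 0) M"
    and "set_pmf q = discrete_interval (Fin 0) N"
    and "Fin 0 \<le> N" and "N \<le> M"
    and "integrable (measure_pmf p) l" and "integrable (measure_pmf q) l"
    and "stein_fun \<eta> p l \<in> stein_class \<eta> p \<inter> stein_class \<eta> q"
  shows "integrable (measure_pmf q) (\<lambda>y. stein_fun \<eta> p l (y + \<eta>) * ratio_diff \<eta> p q y) \<and>
    measure_pmf.expectation q l - measure_pmf.expectation p l =
      measure_pmf.expectation q (\<lambda>y. stein_fun \<eta> p l (y + \<eta>) * ratio_diff \<eta> p q y)"
proof -
  define D where "D = (\<lambda>y. fdiff \<eta> (\<lambda>i. stein_fun \<eta> p l i * pmf q i) y / pmf q y)"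
  have "(fdiff \<eta> (\<lambda>i. stein_fun \<eta> p l i * pmf q i) has_sum 0) (set_pmf q)"
    using assms(10) by (simp add: stein_class_def)
  from expectation_pmf_has_sum[OF this]
  have D: "integrable (measure_pmf q) D" "measure_pmf.expectation q D = 0"
    by (simp_all add: D_def)
  have "set_pmf q \<subseteq> set_pmf p"
    unfolding assms(4,5) discrete_interval_def using assms(7) order_trans by blast
  \<comment> \<open>The pointwise identity requires both masses at \<open>y\<close> to be positive,
    so it is stated almost everywhere under \<open>q\<close>.\<close>
  then have eq: "AE y in measure_pmf q. stein_fun \<eta> p l (y + \<eta>) * ratio_diff \<eta> p q y
      = l y - measure_pmf.expectation p l - D y"
    using stein_fun_mult_ratio_diff[OF assms(1,4)] by (auto simp: AE_measure_pmf_iff D_def)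
  have "integrable (measure_pmf q) (\<lambda>y. l y - measure_pmf.expectation p l - D y)"
    using assms(9) D(1) by simp
  moreover have "measure_pmf.expectation q (\<lambda>y. l y - measure_pmf.expectation p l - D y)
      = measure_pmf.expectation q l - measure_pmf.expectation p l"
    using assms(9) D by simp
  ultimately show ?thesis
    using integrable_cong_AE[OF _ _ eq] integral_cong_AE[OF _ _ eq] by simp
qed

end
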